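(* Let $G$ be a finite simple graph on the vertex set $V$ with a dominating induced matching, and let $\mathcal{M} = \{\{x_{j1}, x_{j2}\} : j = 1, \ldots, m\}$ be a matching of $G$ such that $W = V \setminus \bigcup_{j=1}^m \{x_{j1}, x_{j2}\}$ is an independent set of $G$. Let $\widetilde{G}$ be the graph on the vertex set $W \cup \{x_1, \ldots, x_m\}$ (with new vertices $x_1, \ldots, x_m$) whose edge set is $\{\{w, x_j\} : w \in W,\ \{w, x_{j1}\} \in E(G) \text{ or } \{w, x_{j2}\} \in E(G)\}$ (that is, $\widetilde{G}$ is obtained by identifying $x_{j1}$ and $x_{j2}$ for each $j$). Then $G$ is chordal if and only if $\widetilde{G}$ is a forest.
   Context: All graphs are finite and simple. A matching is a set of pairwise disjoint edges; maximal if no edge can be added. An induced matching is a matching such that no edge of $G$ meets two distinct edges of the matching; a dominating induced matching is an induced matching that is also a maximal matching. A set of vertices is independent if no two are adjacent. A graph is chordal if every cycle of length greater than $3$ has a chord; a forest is a graph without cycles.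
   Formalization: The matching M is required to be itself the dominating induced matching; for an arbitrary matching with W independent the claim fails, e.g. G = C6 with M a perfect matching: W is empty and the identified graph has no edges, so it is a forest, yet C6 is not chordal. *)

theory Defs
  imports Main
begin

text \<open>A graph is a vertex set together with a set of two-element subsets of it.\<close>

type_synonym 'a ugraph = "'a set \<times> 'a set set"

abbreviation verts :: "'a ugraph \<Rightarrow> 'a set" where
  "verts G \<equiv> fst G"

abbreviation edges :: "'a ugraph \<Rightarrow> 'a set set" where
  "edges G \<equiv> snd G"

definition finite_simple_graph :: "'a ugraph \<Rightarrow> bool" where
  "finite_simple_graph G \<longleftrightarrow>
     finite (verts G) \<and> (\<forall>e\<in>edges G. e \<subseteq> verts G \<and> card e = 2)"

definition matching :: "'a ugraph \<Rightarrow> 'a set set \<Rightarrow> bool" where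
  "matching G M \<longleftrightarrow> M \<subseteq> edges G \<and> (\<forall>e\<in>M. \<forall>f\<in>M. e \<noteq> f \<longrightarrow> e \<inter> f = {})"

definition maximal_matching :: "'a ugraph \<Rightarrow> 'a set set \<Rightarrow> bool" where
  "maximal_matching G M \<longleftrightarrow>
     matching G M \<and> (\<forall>e\<in>edges G - M. \<not> matching G (insert e M))"

definition induced_matching :: "'a ugraph \<Rightarrow> 'a set set \<Rightarrow> bool" where
  "induced_matching G M \<longleftrightarrow>
     matching G M \<and>
     \<not> (\<exists>e\<in>edges G. \<exists>f\<in>M. \<exists>g\<in>M. f \<noteq> g \<and> e \<inter> f \<noteq> {} \<and> e \<inter> g \<noteq> {})"

definition dominating_induced_matching :: "'a ugraph \<Rightarrow> 'a set set \<Rightarrow> bool" where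
  "dominating_induced_matching G M \<longleftrightarrow> induced_matching G M \<and> maximal_matching G M"

definition independent_set :: "'a ugraph \<Rightarrow> 'a set \<Rightarrow> bool" where
  "independent_set G S \<longleftrightarrow> S \<subseteq> verts G \<and> (\<forall>u\<in>S. \<forall>v\<in>S. {u, v} \<notin> edges G)"

text \<open>A cycle is given by the list of its distinct vertices in cyclic order; the last
  vertex is adjacent to the first one.\<close>

definition cycle_edges :: "'a list \<Rightarrow> 'a set set" where
  "cycle_edges c = {{c ! i, c ! (Suc i mod length c)} | i. i < length c}"

definition is_cycle :: "'a ugraph \<Rightarrow> 'a list \<Rightarrow> bool" where
  "is_cycle G c \<longleftrightarrow>
     length c \<ge> 3 \<and> distinct c \<and> set c \<subseteq> verts G \<and> cycle_edges c \<subseteq> edges G"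

definition is_chord :: "'a ugraph \<Rightarrow> 'a list \<Rightarrow> 'a set \<Rightarrow> bool" where
  "is_chord G c e \<longleftrightarrow> e \<in> edges G \<and> e \<subseteq> set c \<and> e \<notin> cycle_edges c"

definition chordal :: "'a ugraph \<Rightarrow> bool" where
  "chordal G \<longleftrightarrow> (\<forall>c. is_cycle G c \<and> length c > 3 \<longrightarrow> (\<exists>e. is_chord G c e))"

definition forest :: "'a ugraph \<Rightarrow> bool" where
  "forest G \<longleftrightarrow> \<not> (\<exists>c. is_cycle G c)"

text \<open>The \<open>j\<close>-th matching edge is \<open>{x1 j, x2 j}\<close>, for \<open>j\<close> in \<open>{1..m}\<close>.  A vertex \<open>w\<close>
  of \<open>W\<close> becomes \<open>Inl w\<close>, and \<open>Inr j\<close> is the new vertex obtained by identifying \<open>x1 j\<close>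
  with \<open>x2 j\<close>.  No edges between new vertices are needed: when the matching is induced,
  no edge of \<open>G\<close> joins two different matching edges.\<close>

definition identified_graph ::
  "'a ugraph \<Rightarrow> 'a set \<Rightarrow> nat \<Rightarrow> (nat \<Rightarrow> 'a) \<Rightarrow> (nat \<Rightarrow> 'a) \<Rightarrow> ('a + nat) ugraph" where
  "identified_graph G W m x1 x2 =
     (Inl ` W \<union> Inr ` {1..m},
      {{Inl w, Inr j} | w j. w \<in> W \<and> j \<in> {1..m} \<and>
         ({w, x1 j} \<in> edges G \<or> {w, x2 j} \<in> edges G)})"

end

theory Submission
  imports Defs
begin

text \<open>A finite graph contains a cycle as soon as some nonempty vertex set induces minimum degree
  at least two, so cycles need not be transported between \<open>G\<close> and its quotient vertex by vertex.
  A chordless cycle of length at least four in \<open>G\<close> spans no triangle; hence a vertex of \<open>W\<close> on it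
  sees two different matching edges, a matching edge it meets sees two vertices of \<open>W\<close>, and its
  image has minimum degree two. Conversely, no cycle of a chordal \<open>G\<close> meets two matching edges
  (split it along chords), whereas from a cycle of the quotient one selects a subgraph of \<open>G\<close> of
  minimum degree two in which every cycle meets two matching edges.\<close>

section \<open>Cycles as vertex lists: indices, rotation, neighbours\<close>

text \<open>Trades the index modulo the length for a path condition plus one closing edge, so that
  lists built by \<open>take\<close>, \<open>drop\<close> and \<open>#\<close> can be checked
  without modular arithmetic.\<close>

lemma is_cycle_iff:
  "is_cycle G c \<longleftrightarrow> 3 \<le> length c \<and> distinct c \<and> set c \<subseteq> verts G \<and>
     (\<forall>i. Suc i < length c \<longrightarrow> {c ! i, c ! Suc i} \<in> edges G) \<and>
     {c ! 0, c ! (length c - 1)} \<in> edges G"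
proof -
  have "cycle_edges c \<subseteq> edges G \<longleftrightarrow>
      (\<forall>i. Suc i < length c \<longrightarrow> {c ! i, c ! Suc i} \<in> edges G) \<and>
      {c ! 0, c ! (length c - 1)} \<in> edges G" if "3 \<le> length c"
  proof
    assume sub: "cycle_edges c \<subseteq> edges G"
    have edge: "{c ! i, c ! (Suc i mod length c)} \<in> edges G" if "i < length c" for i
      using sub that unfolding cycle_edges_def by blast
    have "{c ! i, c ! Suc i} \<in> edges G" if "Suc i < length c" for i
      using edge[of i] that by simp
    moreover have "{c ! 0, c ! (length c - 1)} \<in> edges G"
    proof -
      have "Suc (length c - 1) = length c" "length c - 1 < length c"
        using \<open>3 \<le> length c\<close> by auto
      then show ?thesis using edge[of "length c - 1"] by (simp add: insert_commute)
    qed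
    ultimately show "(\<forall>i. Suc i < length c \<longrightarrow> {c ! i, c ! Suc i} \<in> edges G) \<and>
        {c ! 0, c ! (length c - 1)} \<in> edges G" by blast
  next
    assume R: "(\<forall>i. Suc i < length c \<longrightarrow> {c ! i, c ! Suc i} \<in> edges G) \<and>
        {c ! 0, c ! (length c - 1)} \<in> edges G"
    have "{c ! i, c ! (Suc i mod length c)} \<in> edges G" if "i < length c" for i
    proof (cases "Suc i < length c")
      case True
      then show ?thesis using R by simp
    next
      case False
      then have "i = length c - 1" "Suc i = length c" using that by auto
      then show ?thesis using R by (simp add: insert_commute)
    qed
    then show "cycle_edges c \<subseteq> edges G" unfolding cycle_edges_def by blast
  qed
  then show ?thesis unfolding is_cycle_def by blast
qed

lemma cycle_edges_rotate: "cycle_edges (rotate k c) = cycle_edges c"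
proof -
  have sub: "cycle_edges (rotate k c) \<subseteq> cycle_edges c" for k and c :: "'a list"
  proof
    fix e assume "e \<in> cycle_edges (rotate k c)"
    then obtain i where i: "i < length c"
      "e = {rotate k c ! i, rotate k c ! (Suc i mod length c)}"
      unfolding cycle_edges_def by auto
    have "0 < length c" using i(1) by linarith
    then have "(Suc i mod length c) < length c" by simp
    then have "e = {c ! ((k + i) mod length c), c ! (Suc ((k + i) mod length c) mod length c)}"
      using i by (simp add: nth_rotate mod_simps)
    moreover have "(k + i) mod length c < length c" using \<open>0 < length c\<close> by simp
    ultimately show "e \<in> cycle_edges c" unfolding cycle_edges_def by blast
  qed
  \<comment> \<open>A rotation is undone by a further rotation, so applying \<open>sub\<close> to
    both gives the reverse inclusion as well.\<close>
  have "rotate (length c - k mod length c) (rotate k c) = c"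
  proof (cases "c = []")
    case False
    then have "k mod length c \<le> length c" by (simp add: less_imp_le)
    then have "(length c - k mod length c + k) mod length c = 0"
      by (metis le_add_diff_inverse2 mod_add_right_eq mod_self)
    then show ?thesis by (simp only: rotate_rotate rotate_id)
  qed simp
  with sub[of "length c - k mod length c" "rotate k c"] sub[of k c] show ?thesis by simp
qed

lemma is_cycle_rotate: "is_cycle G (rotate k c) \<longleftrightarrow> is_cycle G c"
  unfolding is_cycle_def by (simp add: cycle_edges_rotate)

lemma is_chord_rotate: "is_chord G (rotate k c) e \<longleftrightarrow> is_chord G c e"
  unfolding is_chord_def by (simp add: cycle_edges_rotate)

lemma rotate_to_front:
  assumes "v \<in> set c"
  obtains k where "rotate k c ! 0 = v"
proof -
  obtain i where "i < length c" "c ! i = v" using assms by (auto simp: in_set_conv_nth)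
  then have "rotate i c ! 0 = v" using nth_rotate[of 0 c i] by fastforce
  then show thesis using that by blast
qed

text \<open>Distinctness turns equal vertices into equal indices, and index 0 occurs only in the
  edge starting at index 0 and in the one starting at the last index.\<close>

lemma cycle_edge_at_front:
  assumes "distinct c" "3 \<le> length c" "{c ! 0, v} \<in> cycle_edges c"
  shows "v = c ! 1 \<or> v = c ! (length c - 1)"
proof -
  obtain i where i: "i < length c" "{c ! 0, v} = {c ! i, c ! (Suc i mod length c)}"
    using assms(3) unfolding cycle_edges_def by blast
  have j: "Suc i mod length c < length c" "0 < length c"
    using assms(2) by (auto intro: mod_less_divisor)
  consider "c ! 0 = c ! i" "v = c ! (Suc i mod length c)"
    | "c ! 0 = c ! (Suc i mod length c)" "v = c ! i"
    using i(2) by (auto simp: doubleton_eq_iff)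
  then show ?thesis
  proof cases
    case 1
    then have "i = 0" using nth_eq_iff_index_eq[OF assms(1) j(2) i(1)] by simp
    then show ?thesis using 1 assms(2) by simp
  next
    case 2
    then have "Suc i mod length c = 0" using nth_eq_iff_index_eq[OF assms(1) j(2) j(1)] by simp
    then have "i = length c - 1" using i(1) by (cases "Suc i = length c") auto
    then show ?thesis using 2 by simp
  qed
qed

text \<open>Once \<open>v\<close> is rotated to index 0, its neighbours sit at index 1 and at the
  last index, which differ because the length is at least 3. This reads minimum degree two off a
  cycle; \<open>min_degree_2_imp_cycle\<close> goes the other way.\<close>

lemma cycle_two_neighbours:
  assumes "is_cycle G c" "v \<in> set c"
  obtains a b where "a \<in> set c" "b \<in> set c" "a \<noteq> b" "a \<noteq> v" "b \<noteq> v"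
    "{v, a} \<in> edges G" "{v, b} \<in> edges G"
proof -
  obtain k where k: "rotate k c ! 0 = v" using rotate_to_front[OF assms(2)] .
  define d where "d = rotate k c"
  have d: "is_cycle G d" "set d = set c" "d ! 0 = v"
    using assms(1) k by (auto simp: d_def is_cycle_rotate)
  then have l: "3 \<le> length d" and dist: "distinct d"
    and e: "Suc 0 < length d \<longrightarrow> {d ! 0, d ! Suc 0} \<in> edges G" "{d ! 0, d ! (length d - 1)} \<in> edges G"
    unfolding is_cycle_iff by auto
  show thesis
  proof (rule that)
    show "d ! 1 \<in> set c" "d ! (length d - 1) \<in> set c" using l d(2)
      by (auto intro!: nth_mem)
    have lt: "0 < length d" "1 < length d" "length d - 1 < length d" using l by auto
    show "d ! 1 \<noteq> d ! (length d - 1)" "d ! 1 \<noteq> v" "d ! (length d - 1) \<noteq> v"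
      using l nth_eq_iff_index_eq[OF dist] lt unfolding d(3)[symmetric] by simp_all
    show "{v, d ! 1} \<in> edges G" "{v, d ! (length d - 1)} \<in> edges G"
      using e l d(3) by auto
  qed
qed

section \<open>Chords and chordless cycles\<close>

text \<open>The ends of the chord cut the cycle into two arcs, and the chord closes each of them.
  With one end \<open>a\<close> rotated to index 0 and the other end at index \<open>j\<close>,
  these are the prefix up to \<open>j\<close>, and \<open>a\<close> followed by the suffix from
  \<open>j\<close>.\<close>

lemma cycle_split_at_chord:
  assumes "is_cycle G c" "is_chord G c e" "card e = 2"
  obtains c1 c2 where "is_cycle G c1" "is_cycle G c2" "length c1 < length c" "length c2 < length c"
    "set c1 \<union> set c2 = set c" "e \<subseteq> set c1 \<inter> set c2"
proof -
  obtain a b where e: "e = {a, b}" "a \<noteq> b" using assms(3) by (auto simp: card_2_iff)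
  have "a \<in> set c" using assms(2) e by (auto simp: is_chord_def)
  then obtain k where k: "rotate k c ! 0 = a" using rotate_to_front by metis
  define d where "d = rotate k c"
  have d: "is_cycle G d" "is_chord G d e" "d ! 0 = a" "length d = length c" "set d = set c"
    using assms k by (auto simp: d_def is_cycle_rotate is_chord_rotate)
  then have len: "3 \<le> length d" and dist: "distinct d" and verts: "set d \<subseteq> verts G"
    and step: "\<And>i. Suc i < length d \<Longrightarrow> {d ! i, d ! Suc i} \<in> edges G"
    and close: "{d ! 0, d ! (length d - 1)} \<in> edges G"
    unfolding is_cycle_iff by auto
  have ch: "{a, b} \<in> edges G" "{a, b} \<notin> cycle_edges d" "b \<in> set d"
    using d(2) e by (auto simp: is_chord_def)
  obtain j where j: "j < length d" "d ! j = b" using ch(3) by (auto simp: in_set_conv_nth)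
  have in0: "{d ! i, d ! (Suc i mod length d)} \<in> cycle_edges d" if "i < length d" for i
    using that unfolding cycle_edges_def by blast
  have "j \<noteq> 0" using e(2) j(2) d(3) by metis
  moreover have "j \<noteq> 1" using in0[of 0] len ch(2) d(3) j(2) by (cases "d = []") auto
  moreover have "j \<noteq> length d - 1"
  proof
    assume j': "j = length d - 1"
    then have "Suc j = length d" using len by simp
    then have "Suc j mod length d = 0" by simp
    then show False using in0[OF j(1)] ch(2) d(3) j(2) by (simp add: insert_commute)
  qed
  \<comment> \<open>The bound \<open>2 \<le> j\<close> makes \<open>c1\<close> long enough to be a
    cycle and \<open>c2\<close> shorter than \<open>c\<close>; the bound
    \<open>Suc j < length d\<close> does the same with the roles exchanged.\<close>
  ultimately have jb: "2 \<le> j" "Suc j < length d" using j(1) by auto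
  define c1 where "c1 = take (Suc j) d"
  define c2 where "c2 = a # drop j d"
  have l1: "length c1 = Suc j" and l2: "length c2 = Suc (length d - j)"
    using jb by (auto simp: c1_def c2_def)
  have "a \<notin> set (drop j d)"
  proof -
    have "take j d ! 0 = a" "0 < length (take j d)" using d(3) jb by auto
    then have "a \<in> set (take j d)" using nth_mem by metis
    then show ?thesis using dist set_take_disj_set_drop_if_distinct[of d j j] by blast
  qed
  then have dist2: "distinct c2" using dist by (simp add: c2_def)
  have a: "a \<in> set d" using d(3) len by (metis nth_mem less_le_trans zero_less_numeral)
  have "is_cycle G c1"
    unfolding is_cycle_iff
  proof (intro conjI allI impI)
    show "3 \<le> length c1" using jb l1 by simp
    show "distinct c1" using dist by (simp add: c1_def)
    show "set c1 \<subseteq> verts G" using verts by (auto simp: c1_def dest: in_set_takeD)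
    show "{c1 ! i, c1 ! Suc i} \<in> edges G" if "Suc i < length c1" for i
      using that step[of i] jb l1 by (simp add: c1_def)
    show "{c1 ! 0, c1 ! (length c1 - 1)} \<in> edges G" using ch(1) d(3) j(2) l1 by (simp add: c1_def)
  qed
  moreover have "is_cycle G c2"
    unfolding is_cycle_iff
  proof (intro conjI allI impI)
    show "3 \<le> length c2" using jb l2 by simp
    show "distinct c2" by (fact dist2)
    show "set c2 \<subseteq> verts G" using verts a by (auto simp: c2_def dest: in_set_dropD)
    show "{c2 ! i, c2 ! Suc i} \<in> edges G" if "Suc i < length c2" for i
    proof (cases i)
      case 0
      then show ?thesis using ch(1) j by (simp add: c2_def)
    next
      case (Suc i')
      then show ?thesis using step[of "j + i'"] that l2 by (simp add: c2_def)
    qed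
    have "c2 ! (length c2 - 1) = d ! (length d - 1)" using jb l2 by (simp add: c2_def nth_Cons')
    then show "{c2 ! 0, c2 ! (length c2 - 1)} \<in> edges G" using close d(3) by (simp add: c2_def)
  qed
  moreover have "length c1 < length c" "length c2 < length c"
    using l1 l2 jb d(4) by auto
  moreover have "set c1 \<union> set c2 = set c"
  proof -
    have "set (take (Suc j) d) \<union> set (drop j d) = set d"
      using set_append[of "take j d" "drop j d"] set_take_subset_set_take[of j "Suc j" d]
        set_take_subset[of "Suc j" d] set_drop_subset[of j d] by fastforce
    then show ?thesis using a d(5) by (auto simp: c1_def c2_def)
  qed
  moreover have "e \<subseteq> set c1 \<inter> set c2"
  proof -
    have "a \<in> set c1" using d(3) l1 by (metis c1_def nth_mem nth_take zero_less_Suc)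
    moreover have "b \<in> set c1" using j(2) l1 by (metis c1_def nth_mem nth_take lessI)
    moreover have "b \<in> set c2" using j by (metis c2_def Cons_nth_drop_Suc list.set_intros)
    ultimately show ?thesis using e by (auto simp: c2_def)
  qed
  ultimately show thesis using that by blast
qed

text \<open>Without chords, every edge between vertices of the cycle is a cycle edge. So
  \<open>v\<close> and \<open>w\<close> are the two cycle neighbours of \<open>u\<close>, and these
  are not consecutive once the length exceeds 3.\<close>

lemma chordless_cycle_no_triangle:
  assumes "is_cycle G c" "3 < length c" "\<nexists>e. is_chord G c e"
    and "u \<in> set c" "v \<in> set c" "w \<in> set c" "v \<noteq> w"
    and "{u, v} \<in> edges G" "{u, w} \<in> edges G"
  shows "{v, w} \<notin> edges G"
proof
  assume vw: "{v, w} \<in> edges G"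
  obtain k where k: "rotate k c ! 0 = u" using rotate_to_front[OF assms(4)] .
  define d where "d = rotate k c"
  have d: "is_cycle G d" "d ! 0 = u" "length d = length c" "set d = set c"
    using assms(1) k by (auto simp: d_def is_cycle_rotate)
  have dist: "distinct d" using d(1) by (simp add: is_cycle_def)
  have ce: "e \<in> cycle_edges d" if "e \<in> edges G" "e \<subseteq> set d" for e
    using that assms(3) d(4) by (auto simp: is_chord_def d_def cycle_edges_rotate)
  have len: "3 \<le> length d" using assms(2) d(3) by simp
  have "v = d ! 1 \<or> v = d ! (length d - 1)" "w = d ! 1 \<or> w = d ! (length d - 1)"
    using cycle_edge_at_front[OF dist len] ce assms(4-6,8,9) d(2,4) by simp_all
  then have "{v, w} = {d ! 1, d ! (length d - 1)}" using assms(7) by auto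
  then have "{d ! 1, d ! (length d - 1)} \<in> cycle_edges d"
    using ce[OF vw] assms(5,6) d(4) by (metis insert_subset empty_subsetI)
  then obtain i where i: "i < length d"
    "{d ! 1, d ! (length d - 1)} = {d ! i, d ! (Suc i mod length d)}"
    unfolding cycle_edges_def by blast
  have 4: "4 \<le> length d" using assms(2) d(3) by simp
  have lt: "1 < length d" "length d - 1 < length d" "Suc i mod length d < length d"
    using 4 by (auto intro: mod_less_divisor)
  \<comment> \<open>Indices 1 and \<open>length d - 1\<close> would have to be cyclically
    consecutive: the first case forces length 3, the second forces 0 = 1.\<close>
  have "(1 = i \<and> length d - 1 = Suc i mod length d) \<or> (1 = Suc i mod length d \<and> length d - 1 = i)"
    using i(2) nth_eq_iff_index_eq[OF dist] lt i(1) by (auto simp: doubleton_eq_iff)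
  moreover have "Suc (length d - 1) = length d" using 4 by simp
  then have "Suc (length d - 1) mod length d = 0" by simp
  ultimately show False using 4 by auto
qed

section \<open>Cycles from minimum degree two, and labels on cycles of a chordal graph\<close>

text \<open>In a longest path inside \<open>S\<close>, all neighbours in \<open>S\<close> of the
  first vertex lie on the path. One of them is not the second vertex, and the path up to it closes
  to a cycle.\<close>

lemma min_degree_2_imp_cycle:
  assumes "finite S" "S \<noteq> {}" "S \<subseteq> verts G"
    and deg: "\<And>v. v \<in> S \<Longrightarrow> \<exists>a\<in>S. \<exists>b\<in>S. a \<noteq> b \<and> a \<noteq> v \<and> b \<noteq> v \<and> {v, a} \<in> edges G \<and> {v, b} \<in> edges G"
  obtains c where "is_cycle G c" "set c \<subseteq> S"
proof -
  define P where "P p \<longleftrightarrow> p \<noteq> [] \<and> distinct p \<and> set p \<subseteq> S \<and>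
    (\<forall>i. Suc i < length p \<longrightarrow> {p ! i, p ! Suc i} \<in> edges G)" for p
  obtain s where "s \<in> S" using assms(2) by blast
  then have "P [s]" by (simp add: P_def)
  moreover have bound: "length p < Suc (card S)" if "P p" for p
    using that assms(1) by (metis P_def card_mono distinct_card le_imp_less_Suc)
  ultimately obtain p where p: "P p" and max: "\<And>q. P q \<Longrightarrow> length q \<le> length p"
    using ex_has_greatest_nat[of P "[s]" length "Suc (card S)"] by (metis less_imp_le)
  define v where "v = p ! 0"
  have pn: "p \<noteq> []" "distinct p" "set p \<subseteq> S"
    and step: "\<And>i. Suc i < length p \<Longrightarrow> {p ! i, p ! Suc i} \<in> edges G"
    using p by (auto simp: P_def)
  have "v \<in> S" using pn by (metis length_greater_0_conv nth_mem subsetD v_def)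
  have on_path: "u \<in> set p" if "u \<in> S" "{v, u} \<in> edges G" for u
  proof (rule ccontr)
    assume "u \<notin> set p"
    moreover have "{(u # p) ! i, (u # p) ! Suc i} \<in> edges G" if "Suc i < length (u # p)" for i
      using that step \<open>{v, u} \<in> edges G\<close> by (cases i) (auto simp: v_def insert_commute)
    ultimately have "P (u # p)" using pn \<open>u \<in> S\<close> by (simp add: P_def)
    then show False using max by fastforce
  qed
  obtain a b where ab: "a \<in> S" "b \<in> S" "a \<noteq> b" "a \<noteq> v" "b \<noteq> v" "{v, a} \<in> edges G" "{v, b} \<in> edges G"
    using deg[OF \<open>v \<in> S\<close>] by blast
  \<comment> \<open>If the path has a single vertex, \<open>p ! 1\<close> is an unspecified value;
    the choice still works, since at most one of \<open>a\<close> and \<open>b\<close> can equal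
    it.\<close>
  have "\<exists>u. u \<in> set p \<and> u \<noteq> p ! 0 \<and> u \<noteq> p ! 1 \<and> {v, u} \<in> edges G"
    using ab on_path unfolding v_def by metis
  then obtain j where j: "j < length p" "p ! j \<noteq> p ! 0" "p ! j \<noteq> p ! 1" "{v, p ! j} \<in> edges G"
    by (auto simp: in_set_conv_nth)
  then have "j \<noteq> 0" "j \<noteq> 1" by metis+
  then have "2 \<le> j" by simp
  have sub: "set (take (Suc j) p) \<subseteq> S" using pn(3) by (auto dest: in_set_takeD)
  have "is_cycle G (take (Suc j) p)"
    unfolding is_cycle_iff using \<open>2 \<le> j\<close> j(1,4) pn(2) step sub assms(3)
    by (auto simp: v_def)
  then show thesis using that sub by blast
qed

text \<open>A chord contains a vertex of \<open>X\<close>, which lies on both cycles into which it splits \<open>c\<close>;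
  so if each of those cycles carries one label only, the two labels agree.\<close>

lemma chordal_cycle_label_unique:
  assumes "finite_simple_graph G" "chordal G"
    and cover: "\<And>e. e \<in> edges G \<Longrightarrow> e \<inter> X \<noteq> {}"
    and label: "\<And>u v. u \<in> X \<Longrightarrow> v \<in> X \<Longrightarrow> {u, v} \<in> edges G \<Longrightarrow> h u = h v"
    and "is_cycle G c" "a \<in> set c \<inter> X" "b \<in> set c \<inter> X"
  shows "h a = h b"
  using assms(5-7)
proof (induction "length c" arbitrary: c a b rule: less_induct)
  case less
  show ?case
  proof (cases "length c = 3")
    case True
    then obtain p q r where c: "c = [p, q, r]"
      by (auto simp: numeral_3_eq_3 length_Suc_conv)
    have "{p, q} \<in> edges G" "{q, r} \<in> edges G" "{p, r} \<in> edges G"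
      using less.prems(1) unfolding is_cycle_iff c by force+
    \<comment> \<open>Base case: any two vertices of a triangle are equal or adjacent, so
      \<open>label\<close> compares them directly.\<close>
    then have "u = v \<or> {u, v} \<in> edges G" if "u \<in> set c" "v \<in> set c" for u v
      using that by (auto simp: c insert_commute)
    then show ?thesis using less.prems label by blast
  next
    case False
    then have "3 < length c" using less.prems(1) by (simp add: is_cycle_def)
    then obtain e where e: "is_chord G c e"
      using assms(2) less.prems(1) by (auto simp: chordal_def)
    then have "e \<in> edges G" "card e = 2"
      using assms(1) by (auto simp: is_chord_def finite_simple_graph_def)
    then obtain x where x: "x \<in> e" "x \<in> X" using cover by blast
    obtain c1 c2 where *: "is_cycle G c1" "is_cycle G c2" "length c1 < length c" "length c2 < length c"
      "set c1 \<union> set c2 = set c" "e \<subseteq> set c1 \<inter> set c2"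
      using cycle_split_at_chord[OF less.prems(1) e \<open>card e = 2\<close>] by metis
    have "h v = h x" if "v \<in> set c \<inter> X" for v
      using that less.hyps[OF *(3,1), of v x] less.hyps[OF *(4,2), of v x] * x by blast
    then show ?thesis using less.prems by metis
  qed
qed

section \<open>Disjoint matched pairs with an independent complement\<close>

text \<open>The assumption \<open>pairs_apart\<close> merges two facts: its case
  \<open>u = v\<close> says that distinct pairs are disjoint, its edge case that no edge joins
  distinct pairs, i.e. that the matching is induced.\<close>

locale paired_graph =
  fixes G :: "'a ugraph" and x1 x2 :: "nat \<Rightarrow> 'a" and m :: nat and W :: "'a set"
  assumes simple: "finite_simple_graph G"
    and pair_edge: "j \<in> {1..m} \<Longrightarrow> {x1 j, x2 j} \<in> edges G"
    and pairs_apart: "\<lbrakk>i \<in> {1..m}; j \<in> {1..m}; u \<in> {x1 i, x2 i}; v \<in> {x1 j, x2 j}; u = v \<or> {u, v} \<in> edges G\<rbrakk> \<Longrightarrow> i = j"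
    and W_def: "W = verts G - (\<Union>j\<in>{1..m}. {x1 j, x2 j})"
    and W_indep: "\<lbrakk>u \<in> W; v \<in> W\<rbrakk> \<Longrightarrow> {u, v} \<notin> edges G"
begin

abbreviation "H \<equiv> identified_graph G W m x1 x2"

lemma edge_verts: "{u, v} \<in> edges G \<Longrightarrow> u \<in> verts G \<and> v \<in> verts G \<and> u \<noteq> v"
  using simple by (fastforce simp: finite_simple_graph_def)

lemma vert_cases:
  assumes "v \<in> verts G"
  obtains "v \<in> W" | j where "j \<in> {1..m}" "v \<in> {x1 j, x2 j}"
  using assms W_def by blast

lemma W_not_pair: "\<lbrakk>w \<in> W; j \<in> {1..m}\<rbrakk> \<Longrightarrow> w \<noteq> x1 j \<and> w \<noteq> x2 j"
  using W_def by blast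

lemma pair_distinct: "j \<in> {1..m} \<Longrightarrow> x1 j \<noteq> x2 j"
  using pair_edge edge_verts by blast

lemma W_neighbour:
  assumes "w \<in> W" "{w, v} \<in> edges G"
  obtains j where "j \<in> {1..m}" "v \<in> {x1 j, x2 j}"
  using assms edge_verts W_indep vert_cases by metis

lemma pair_neighbour:
  assumes "j \<in> {1..m}" "u \<in> {x1 j, x2 j}" "{u, v} \<in> edges G"
  shows "v \<in> W \<or> v \<in> {x1 j, x2 j}"
  using assms edge_verts pairs_apart vert_cases by metis

lemma H_edge_iff:
  "{Inl w, Inr j} \<in> edges H \<longleftrightarrow>
     w \<in> W \<and> j \<in> {1..m} \<and> ({w, x1 j} \<in> edges G \<or> {w, x2 j} \<in> edges G)"
  by (auto simp: identified_graph_def doubleton_eq_iff)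

lemma H_edge_iff': "{Inr j, Inl w} \<in> edges H \<longleftrightarrow> {Inl w, Inr j} \<in> edges H"
  by (simp add: insert_commute)

lemma H_edge_cases:
  assumes "{p, q} \<in> edges H"
  shows "(\<exists>w j. p = Inl w \<and> q = Inr j) \<or> (\<exists>w j. p = Inr j \<and> q = Inl w)"
  using assms by (auto simp: identified_graph_def doubleton_eq_iff)

section \<open>From a forest quotient to a chordal graph\<close>

lemma forest_imp_chordal:
  assumes "forest H"
  shows "chordal G"
proof (rule ccontr)
  assume "\<not> chordal G"
  then obtain c where c: "is_cycle G c" "3 < length c" "\<nexists>e. is_chord G c e"
    by (auto simp: chordal_def)
  \<comment> \<open>The image of the vertices of \<open>c\<close> under the identification.\<close>
  define S where "S = Inl ` (set c \<inter> W) \<union> Inr ` {j \<in> {1..m}. {x1 j, x2 j} \<inter> set c \<noteq> {}}"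
  have cv: "set c \<subseteq> verts G" "c \<noteq> []" using c by (auto simp: is_cycle_def)
  have no_triangle: False
    if "w \<in> set c \<inter> W" "j \<in> {1..m}" "{x1 j, x2 j} \<subseteq> set c" "{w, x1 j} \<in> edges G" "{w, x2 j} \<in> edges G" for w j
    using chordless_cycle_no_triangle[OF c, of w "x1 j" "x2 j"] that pair_edge pair_distinct by auto
  have deg: "\<exists>a\<in>S. \<exists>b\<in>S. a \<noteq> b \<and> a \<noteq> s \<and> b \<noteq> s \<and> {s, a} \<in> edges H \<and> {s, b} \<in> edges H"
    if "s \<in> S" for s
  proof (cases s)
    case (Inl w)
    then have w: "w \<in> set c" "w \<in> W" using that by (auto simp: S_def)
    obtain a b where ab: "a \<in> set c" "b \<in> set c" "a \<noteq> b" "{w, a} \<in> edges G" "{w, b} \<in> edges G"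
      using cycle_two_neighbours[OF c(1) w(1)] by metis
    obtain i where i: "i \<in> {1..m}" "a \<in> {x1 i, x2 i}" using W_neighbour[OF w(2) ab(4)] .
    obtain j where j: "j \<in> {1..m}" "b \<in> {x1 j, x2 j}" using W_neighbour[OF w(2) ab(5)] .
    \<comment> \<open>If both neighbours lay in one pair they would be its two ends, forming a
      triangle with \<open>w\<close>.\<close>
    have "i \<noteq> j"
    proof
      assume "i = j"
      then show False using no_triangle[of w j] i j ab w by auto
    qed
    moreover have "Inr i \<in> S" "Inr j \<in> S" using i j ab by (auto simp: S_def)
    moreover have "{s, Inr i} \<in> edges H" "{s, Inr j} \<in> edges H"
      unfolding Inl H_edge_iff using w i j ab by auto
    ultimately show ?thesis using Inl by blast
  next
    case (Inr j)
    then obtain u where u: "j \<in> {1..m}" "u \<in> {x1 j, x2 j}" "u \<in> set c"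
      using \<open>s \<in> S\<close> by (auto simp: S_def)
    have in_S: "Inl w \<in> S \<and> {Inr j, Inl w} \<in> edges H"
      if "w \<in> W" "w \<in> set c" "v \<in> {x1 j, x2 j}" "{v, w} \<in> edges G" for v w
      using that u by (auto simp: S_def H_edge_iff H_edge_iff' insert_commute)
    obtain a b where ab: "a \<in> set c" "b \<in> set c" "a \<noteq> b" "a \<noteq> u" "b \<noteq> u" "{u, a} \<in> edges G" "{u, b} \<in> edges G"
      using cycle_two_neighbours[OF c(1) u(3)] .
    \<comment> \<open>Here \<open>a\<close> is a neighbour of \<open>u\<close> in \<open>W\<close>.
      If \<open>b\<close> is not in \<open>W\<close>, it is the partner of \<open>u\<close>; its
      further cycle neighbour \<open>d\<close> then lies in \<open>W\<close>, and
      \<open>d = a\<close> would give a triangle on \<open>a\<close> and the pair.\<close>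
    have two: "\<exists>p q. p \<in> W \<and> q \<in> W \<and> p \<in> set c \<and> q \<in> set c \<and> p \<noteq> q \<and>
        (\<exists>v\<in>{x1 j, x2 j}. {v, p} \<in> edges G) \<and> (\<exists>v\<in>{x1 j, x2 j}. {v, q} \<in> edges G)"
      if ab: "a \<in> set c" "b \<in> set c" "a \<noteq> b" "b \<noteq> u" "{u, a} \<in> edges G" "{u, b} \<in> edges G" "a \<in> W" for a b
    proof (cases "b \<in> W")
      case True
      then show ?thesis using ab u by blast
    next
      case False
      then have b: "b \<in> {x1 j, x2 j}" using pair_neighbour[OF u(1,2) ab(6)] by blast
      obtain d where d: "d \<in> set c" "d \<noteq> u" "d \<noteq> b" "{b, d} \<in> edges G"
        using cycle_two_neighbours[OF c(1) ab(2)] by metis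
      have "d \<notin> {x1 j, x2 j}" using d b u ab(4) by auto
      then have "d \<in> W" using pair_neighbour[OF u(1) b d(4)] by blast
      have "a \<noteq> d"
      proof
        assume "a = d"
        then show False
          using no_triangle[of a j] u b d ab by (auto simp: insert_commute)
      qed
      then show ?thesis using ab d \<open>d \<in> W\<close> u b by blast
    qed
    \<comment> \<open>Only one vertex other than \<open>u\<close> belongs to the pair, so
      \<open>a\<close> and \<open>b\<close> cannot both be in it.\<close>
    have "a \<in> W \<or> b \<in> W"
      using pair_neighbour[OF u(1,2) ab(6)] pair_neighbour[OF u(1,2) ab(7)] ab u by auto
    then obtain p q where "p \<in> W" "q \<in> W" "p \<in> set c" "q \<in> set c" "p \<noteq> q"
        "\<exists>v\<in>{x1 j, x2 j}. {v, p} \<in> edges G" "\<exists>v\<in>{x1 j, x2 j}. {v, q} \<in> edges G"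
      using two[of a b] two[of b a] ab by metis
    then have "Inl p \<in> S" "Inl q \<in> S" "{s, Inl p} \<in> edges H" "{s, Inl q} \<in> edges H" "p \<noteq> q"
      using in_S Inr by blast+
    then show ?thesis using Inr by blast
  qed
  have "c ! 0 \<in> set c" using cv by simp
  moreover have "S \<noteq> {}" if "v \<in> set c" for v
    by (rule vert_cases[of v]) (use that cv in \<open>auto simp: S_def\<close>)
  ultimately have "S \<noteq> {}" by blast
  moreover have "finite S" "S \<subseteq> verts H" by (auto simp: S_def identified_graph_def)
  ultimately obtain d where "is_cycle H d" using min_degree_2_imp_cycle[of S H] deg by metis
  then show False using assms by (auto simp: forest_def)
qed

section \<open>From a chordal graph to a forest quotient\<close>

lemma chordal_imp_forest:
  assumes "chordal G"
  shows "forest H"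
  unfolding forest_def
proof
  assume "\<exists>d. is_cycle H d"
  then obtain d where d: "is_cycle H d" by blast
  \<comment> \<open>\<open>T\<close> records all edges of the quotient between vertices of
    \<open>d\<close>, including possible chords of \<open>d\<close>.\<close>
  define T where "T w j \<longleftrightarrow> Inl w \<in> set d \<and> Inr j \<in> set d \<and> {Inl w, Inr j} \<in> edges H" for w j
  define f where "f w j = (if {w, x1 j} \<in> edges G then x1 j else x2 j)" for w j
  \<comment> \<open>Joining \<open>w\<close> to only one end of each matching edge excludes the triangles
    \<open>w, x1 j, x2 j\<close>, the only cycles that could stay within one matching edge.\<close>
  define K where "K = (verts G, {{w, f w j} | w j. T w j} \<union> {{x1 j, x2 j} | j. j \<in> {1..m}})"
  \<comment> \<open>Only ends chosen by some \<open>w\<close> are included: an unchosen end has at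
    most its partner as a neighbour in \<open>K\<close>.\<close>
  define S where "S = {w. Inl w \<in> set d} \<union> {f w j | w j. T w j}"
  have T: "w \<in> W" "j \<in> {1..m}" "f w j \<in> {x1 j, x2 j}" "{w, f w j} \<in> edges G" if "T w j" for w j
    using that by (auto simp: T_def H_edge_iff f_def)
  have KG: "edges K \<subseteq> edges G" "verts K = verts G"
    using T(4) pair_edge by (auto simp: K_def)
  have pick_edge: "{w, f w j} \<in> edges K" "{f w j, w} \<in> edges K" if "T w j" for w j
    using that by (auto simp: K_def insert_commute)
  have twoW: "\<exists>i j. i \<noteq> j \<and> T w i \<and> T w j" if w: "Inl w \<in> set d" for w
  proof -
    obtain a b where ab: "a \<in> set d" "b \<in> set d" "a \<noteq> b" "{Inl w, a} \<in> edges H" "{Inl w, b} \<in> edges H"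
      using cycle_two_neighbours[OF d w] by metis
    obtain i where "a = Inr i" using H_edge_cases[OF ab(4)] by auto
    moreover obtain j where "b = Inr j" using H_edge_cases[OF ab(5)] by auto
    ultimately show ?thesis using ab w by (auto simp: T_def)
  qed
  have twoX: "\<exists>p q. p \<noteq> q \<and> T p j \<and> T q j" if j: "Inr j \<in> set d" for j
  proof -
    obtain a b where ab: "a \<in> set d" "b \<in> set d" "a \<noteq> b" "{Inr j, a} \<in> edges H" "{Inr j, b} \<in> edges H"
      using cycle_two_neighbours[OF d j] by metis
    obtain p where "a = Inl p" using H_edge_cases[OF ab(4)] by auto
    moreover obtain q where "b = Inl q" using H_edge_cases[OF ab(5)] by auto
    ultimately show ?thesis using ab j by (auto simp: T_def H_edge_iff')
  qed
  have SV: "S \<subseteq> verts G"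
    using T(4) edge_verts twoW unfolding S_def by blast
  have SW: "w \<in> S" "f w j \<in> S" if "T w j" for w j
    using that by (auto simp: S_def T_def)
  have deg: "\<exists>a\<in>S. \<exists>b\<in>S. a \<noteq> b \<and> a \<noteq> s \<and> b \<noteq> s \<and> {s, a} \<in> edges K \<and> {s, b} \<in> edges K"
    if "s \<in> S" for s
  proof -
    have ne: "a \<noteq> s" if "{s, a} \<in> edges K" for a using that KG(1) edge_verts by blast
    have "\<exists>a\<in>S. \<exists>b\<in>S. a \<noteq> b \<and> {s, a} \<in> edges K \<and> {s, b} \<in> edges K"
    proof (cases "Inl s \<in> set d")
      case True
      then obtain i j where "i \<noteq> j" and ij: "T s i" "T s j" using twoW by blast
      \<comment> \<open>The chosen ends belong to different pairs, which are disjoint.\<close>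
      then have "f s i \<noteq> f s j" using T(2,3) pairs_apart by metis
      then show ?thesis using ij SW pick_edge by blast
    next
      case False
      then obtain w j where w: "T w j" "s = f w j" using \<open>s \<in> S\<close> by (auto simp: S_def)
      obtain w' where w': "T w' j" "w' \<noteq> w" using w(1) twoX[of j] by (auto simp: T_def)
      show ?thesis
      \<comment> \<open>If \<open>w\<close> and \<open>w'\<close> choose the same end
        \<open>s\<close>, both are neighbours of \<open>s\<close>. Otherwise \<open>w'\<close> chose
        the partner of \<open>s\<close>, and the neighbours are \<open>w\<close> and that
        partner.\<close>
      proof (cases "f w' j = s")
        case True
        then show ?thesis using w w' SW pick_edge by metis
      next
        case False
        then have "{s, f w' j} = {x1 j, x2 j}" using T(3)[OF w(1)] T(3)[OF w'(1)] w(2) by auto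
        then have "{s, f w' j} \<in> edges K" using T(2)[OF w(1)] by (auto simp: K_def)
        moreover have "f w' j \<noteq> w"
          using T(1,2)[OF w(1)] T(3)[OF w'(1)] W_not_pair by blast
        ultimately show ?thesis using w w' SW pick_edge by metis
      qed
    qed
    then show ?thesis using ne by blast
  qed
  have "d ! 0 \<in> set d" using d by (auto simp: is_cycle_def intro: nth_mem)
  then have "\<exists>w j. T w j" using twoW twoX by (metis sum.exhaust)
  then have "S \<noteq> {}" using SW by blast
  moreover have "finite S"
    using SV simple finite_subset by (auto simp: finite_simple_graph_def)
  ultimately obtain c where c: "is_cycle K c"
    using min_degree_2_imp_cycle[of S K] SV KG(2) deg by metis
  \<comment> \<open>The cycle is found in the sparser \<open>K\<close> but also viewed in
    \<open>G\<close>, where chordality confines it to one pair.\<close>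
  then have cG: "is_cycle G c" using KG by (auto simp: is_cycle_def)
  \<comment> \<open>The index of the pair containing \<open>v\<close>, unique by
    \<open>pairs_apart\<close>; outside the pairs the value is unspecified, and \<open>h\<close> is
    only compared on \<open>X\<close>.\<close>
  define h where "h v = (THE j. j \<in> {1..m} \<and> v \<in> {x1 j, x2 j})" for v
  have h: "h v = j" if "j \<in> {1..m}" "v \<in> {x1 j, x2 j}" for v j
    unfolding h_def
  proof (rule the_equality)
    show "j \<in> {1..m} \<and> v \<in> {x1 j, x2 j}" using that by blast
    show "i = j" if "i \<in> {1..m} \<and> v \<in> {x1 i, x2 i}" for i
      using pairs_apart[of i j v v] that \<open>j \<in> {1..m}\<close> \<open>v \<in> {x1 j, x2 j}\<close> by blast
  qed
  define X where "X = (\<Union>j\<in>{1..m}. {x1 j, x2 j})"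
  have cover: "e \<inter> X \<noteq> {}" if "e \<in> edges G" for e
  proof -
    have "card e = 2" using that simple by (auto simp: finite_simple_graph_def)
    then obtain u v where e: "e = {u, v}" by (auto simp: card_2_iff)
    then have "u \<in> verts G" "v \<in> verts G" "u \<notin> W \<or> v \<notin> W"
      using that W_indep[of u v] edge_verts[of u v] by auto
    then show ?thesis unfolding e X_def W_def by blast
  qed
  have label: "h u = h v" if "u \<in> X" "v \<in> X" "{u, v} \<in> edges G" for u v
  proof -
    obtain i j where ij: "i \<in> {1..m}" "u \<in> {x1 i, x2 i}" "j \<in> {1..m}" "v \<in> {x1 j, x2 j}"
      using \<open>u \<in> X\<close> \<open>v \<in> X\<close> unfolding X_def by blast
    then have "i = j" using pairs_apart that(3) by blast
    then show ?thesis using h[OF ij(1,2)] h[OF ij(3,4)] by simp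
  qed
  have same: "i = j"
    if "u \<in> set c" "v \<in> set c" "i \<in> {1..m}" "j \<in> {1..m}" "u \<in> {x1 i, x2 i}" "v \<in> {x1 j, x2 j}" for u v i j
  proof -
    have "u \<in> set c \<inter> X" "v \<in> set c \<inter> X" using that by (auto simp: X_def)
    note chordal_cycle_label_unique[OF simple assms _ _ cG this]
    then have "h u = h v" using cover label by blast
    then show ?thesis using h[OF that(3,5)] h[OF that(4,6)] by simp
  qed
  \<comment> \<open>In \<open>K\<close>, a vertex of \<open>W\<close> has at most one neighbour in
    each pair, so its two neighbours on \<open>c\<close> would lie in different pairs, against
    \<open>same\<close>.\<close>
  have noW: "v \<notin> W" if v: "v \<in> set c" for v
  proof
    assume vW: "v \<in> W"
    obtain a b where ab: "a \<in> set c" "b \<in> set c" "a \<noteq> b" "{v, a} \<in> edges K" "{v, b} \<in> edges K"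
      using cycle_two_neighbours[OF c v] by metis
    have pick: "\<exists>j. u = f v j \<and> T v j" if "{v, u} \<in> edges K" for u
    proof -
      from that consider w j where "T w j" "{v, u} = {w, f w j}"
        | j where "j \<in> {1..m}" "{v, u} = {x1 j, x2 j}"
        unfolding K_def by auto
      then show ?thesis
      proof cases
        case 1
        then have "v \<noteq> f w j" using W_not_pair[OF vW T(2)] T(3) by blast
        then show ?thesis using 1 by (auto simp: doubleton_eq_iff)
      next
        case 2
        then show ?thesis using W_not_pair[OF vW] by (auto simp: doubleton_eq_iff)
      qed
    qed
    obtain i where i: "a = f v i" "T v i" using pick ab(4) by blast
    obtain j where j: "b = f v j" "T v j" using pick ab(5) by blast
    have "i = j" 
      using same[OF ab(1,2) T(2)[OF i(2)] T(2)[OF j(2)]] T(3)[OF i(2)] T(3)[OF j(2)] i(1) j(1) by simp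
    then show False using i j ab(3) by simp
  qed
  have "c ! 0 \<in> set c" using c by (auto simp: is_cycle_def intro: nth_mem)
  then obtain v where v: "v \<in> set c" by blast
  then have "v \<in> verts G" using cG by (auto simp: is_cycle_def)
  then obtain j where j: "j \<in> {1..m}" "v \<in> {x1 j, x2 j}"
    using noW[OF v] unfolding W_def by blast
  obtain a b where ab: "a \<in> set c" "b \<in> set c" "a \<noteq> b" "a \<noteq> v" "b \<noteq> v" "{v, a} \<in> edges G" "{v, b} \<in> edges G"
    using cycle_two_neighbours[OF cG v] .
  \<comment> \<open>With no vertex of \<open>W\<close> on \<open>c\<close>, the three distinct
    vertices \<open>v\<close>, \<open>a\<close>, \<open>b\<close> would all fit into one
    pair.\<close>
  have "a \<in> {x1 j, x2 j}" "b \<in> {x1 j, x2 j}"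
    using pair_neighbour[OF j] ab noW by blast+
  then show False using ab(3-5) j(2) by auto
qed

end

section \<open>The equivalence for a dominating induced matching\<close>

theorem theorem2p8:
  fixes G :: "'a ugraph"
    and x1 x2 :: "nat \<Rightarrow> 'a"
    and m :: nat
    and M :: "'a set set"
    and W :: "'a set"
  assumes "finite_simple_graph G"
    and "M = (\<lambda>j. {x1 j, x2 j}) ` {1..m}"
    and "inj_on (\<lambda>j. {x1 j, x2 j}) {1..m}"
    and "dominating_induced_matching G M"
    and "W = verts G - (\<Union>j\<in>{1..m}. {x1 j, x2 j})"
    and "independent_set G W"
  shows "chordal G \<longleftrightarrow> forest (identified_graph G W m x1 x2)"
proof -
  have im: "induced_matching G M" and mm: "matching G M"
    using assms(4) by (auto simp: dominating_induced_matching_def induced_matching_def)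
  have pe: "{x1 j, x2 j} \<in> M" if "j \<in> {1..m}" for j unfolding assms(2) using that by (rule imageI)
  interpret paired_graph G x1 x2 m W
  proof
    show "finite_simple_graph G" by fact
    show "{x1 j, x2 j} \<in> edges G" if "j \<in> {1..m}" for j
      using mm pe[OF that] unfolding matching_def by blast
    show "i = j" if "i \<in> {1..m}" "j \<in> {1..m}" "u \<in> {x1 i, x2 i}" "v \<in> {x1 j, x2 j}"
      "u = v \<or> {u, v} \<in> edges G" for i j u v
    proof (rule ccontr)
      assume "i \<noteq> j"
      \<comment> \<open>\<open>M\<close> is a set of edges, so injectivity is what turns distinct
        indices into distinct members of \<open>M\<close>.\<close>
      then have ne: "{x1 i, x2 i} \<noteq> {x1 j, x2 j}"
        using inj_onD[OF assms(3), of i j] that(1,2) by blast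
      moreover have "\<forall>e\<in>M. \<forall>f\<in>M. e \<noteq> f \<longrightarrow> e \<inter> f = {}" using mm by (simp add: matching_def)
      ultimately have "{x1 i, x2 i} \<inter> {x1 j, x2 j} = {}"
        using pe[OF that(1)] pe[OF that(2)] by (meson bspec)
      \<comment> \<open>Disjointness excludes \<open>u = v\<close>; the remaining edge would meet
        two members of \<open>M\<close>, which inducedness forbids.\<close>
      then have "u \<noteq> v" using that(3,4) by blast
      then have "{u, v} \<in> edges G" using that(5) by simp
      moreover have "{u, v} \<inter> {x1 i, x2 i} \<noteq> {}" "{u, v} \<inter> {x1 j, x2 j} \<noteq> {}"
        using that(3,4) by blast+
      moreover have "\<not> (\<exists>e\<in>edges G. \<exists>f\<in>M. \<exists>g\<in>M. f \<noteq> g \<and> e \<inter> f \<noteq> {} \<and> e \<inter> g \<noteq> {})"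
        using im by (simp add: induced_matching_def)
      ultimately show False using pe[OF that(1)] pe[OF that(2)] ne by (meson bexI)
    qed
    show "W = verts G - (\<Union>j\<in>{1..m}. {x1 j, x2 j})" by fact
    show "{u, v} \<notin> edges G" if "u \<in> W" "v \<in> W" for u v
      using that assms(6) unfolding independent_set_def by blast
  qed
  show ?thesis by (rule iffI[OF chordal_imp_forest forest_imp_chordal])
qed

end
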